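(* Every mono-unstable $0$-skeleton in any dimension has at least $11$ vertices. That is, for every integer $d\ge 1$, if a $d$-dimensional convex polytope $P\subseteq\mathbb{R}^d$ is mono-unstable as a $0$-skeleton, then $P$ has at least $11$ vertices.
   Context: Let $P\subseteq\mathbb{R}^d$ be a $d$-dimensional (bounded) convex polytope with vertices $r_1,\dots,r_V$. Regarded as a $0$-skeleton, $P$ carries a unit point mass at each of its vertices (and no other mass), so its center of mass is $g=\frac1V\sum_{i=1}^V r_i$, which lies in the interior of $P$. A point $q$ of the boundary of $P$ is an equilibrium point (with respect to $g$) if the hyperplane $h$ through $q$ perpendicular to the line segment $[g,q]$ supports $P$ at $q$. An equilibrium point $q$ is nondegenerate if $h\cap P$ is the unique face of $P$ (of dimension $k\in\{0,1,\dots,d-1\}$) that contains $q$ in its relative interior. A nondegenerate equilibrium point $q$ is unstable if $\dim(h\cap P)=0$; equivalently, $q$ is a vertex of $P$ and $h\cap P=\{q\}$. Only nondegenerate equilibrium points are counted; $U$ denotes the number of unstable equilibria. A $0$-skeleton is mono-unstable if $U=1$. *)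

theory Defs
  imports "HOL-Analysis.Analysis"
begin

definition vertices :: "'a::euclidean_space set \<Rightarrow> 'a set" where
  "vertices P = {v. v extreme_point_of P}"

definition center_of_mass_0_skeleton :: "'a::euclidean_space set \<Rightarrow> 'a" where
  "center_of_mass_0_skeleton P = (1 / real (card (vertices P))) *\<^sub>R (\<Sum>v\<in>vertices P. v)"

text \<open>The condition \<^prop>\<open>a \<noteq> 0\<close> makes \<^term>\<open>h\<close> a genuine hyperplane. Since the pair
  \<^term>\<open>a\<close>, \<^term>\<open>b\<close> may be replaced by its negative, the choice of side is immaterial.\<close>

definition supports_at :: "'a::euclidean_space set \<Rightarrow> 'a set \<Rightarrow> 'a \<Rightarrow> bool" where
  "supports_at h P q \<longleftrightarrow>
     (\<exists>a b. a \<noteq> 0 \<and> h = {x. a \<bullet> x = b} \<and> P \<subseteq> {x. a \<bullet> x \<le> b}) \<and> q \<in> h \<inter> P"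

text \<open>For \<^prop>\<open>q = g\<close> the following set is the whole space and supports nothing.\<close>

definition perp_hyperplane :: "'a::euclidean_space \<Rightarrow> 'a \<Rightarrow> 'a set" where
  "perp_hyperplane g q = {x. (q - g) \<bullet> (x - q) = 0}"

definition equilibrium_point :: "'a::euclidean_space set \<Rightarrow> 'a \<Rightarrow> 'a \<Rightarrow> bool" where
  "equilibrium_point P g q \<longleftrightarrow> q \<in> frontier P \<and> supports_at (perp_hyperplane g q) P q"

text \<open>The faces of \<^const>\<open>face_of\<close> include the empty set and \<^term>\<open>P\<close> itself; the bounds on the
  dimension exclude these for a full-dimensional \<^term>\<open>P\<close>.\<close>

definition nondegenerate_equilibrium :: "'a::euclidean_space set \<Rightarrow> 'a \<Rightarrow> 'a \<Rightarrow> bool" where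
  "nondegenerate_equilibrium P g q \<longleftrightarrow> equilibrium_point P g q \<and>
     {F. F face_of P \<and> 0 \<le> aff_dim F \<and> aff_dim F \<le> int DIM('a) - 1 \<and> q \<in> rel_interior F}
       = {perp_hyperplane g q \<inter> P}"

definition unstable_equilibrium :: "'a::euclidean_space set \<Rightarrow> 'a \<Rightarrow> 'a \<Rightarrow> bool" where
  "unstable_equilibrium P g q \<longleftrightarrow>
     nondegenerate_equilibrium P g q \<and> aff_dim (perp_hyperplane g q \<inter> P) = 0"

definition mono_unstable_0_skeleton :: "'a::euclidean_space set \<Rightarrow> bool" where
  "mono_unstable_0_skeleton P \<longleftrightarrow>
     card {q. unstable_equilibrium P (center_of_mass_0_skeleton P) q} = 1"

end

theory Submission
  imports Defs
begin

text \<open>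
  Put the center of mass at the origin, so that the vertices are vectors with sum zero. A vertex
  \<open>x\<close> is an unstable equilibrium as soon as \<open>x \<bullet> y < x \<bullet> x\<close> for all other vertices \<open>y\<close>
  (\<open>strict_maximum_imp_unstable\<close>), and the longest vertex has this property. In a mono-unstable
  skeleton every other vertex \<open>x\<close> therefore has a \<^emph>\<open>parent\<close> \<open>y \<noteq> x\<close> with \<open>x \<bullet> x \<le> x \<bullet> y\<close>;
  geometrically, \<open>x\<close> lies in the ball with diameter \<open>[0, y]\<close>, and \<open>y\<close> is strictly longer. The
  vertices form a tree rooted at the longest one, \<open>r\<close>. It has to be shown that a tree of at most ten
  vectors with \<open>r \<noteq> 0\<close> cannot have sum zero (\<open>balanced_arborescence\<close>).

  Trees reduce to paths (\<open>exists_path_below\<close>). Fix a direction \<open>u\<close> and let \<open>w\<close> be the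
  vector of the tree on which \<open>u\<close> is smallest. Replacing each vector off the path from the root to
  \<open>w\<close> by another copy of \<open>w\<close> can only decrease the sum of the values of \<open>u\<close>, and since \<open>w\<close>
  may serve as its own parent, the result is a single path with the same root and size. For a path
  from \<open>r\<close> with sum \<open>t\<close>, eliminating its vectors one at a time from the far end by completing
  squares gives lower bounds \<open>u \<bullet> t \<ge> - a \<parallel>r\<parallel>\<^sup>2 + b (u \<bullet> r) - c \<parallel>u\<parallel>\<^sup>2\<close>
  that are valid for all \<open>u\<close> simultaneously (\<open>path_cert_bound\<close>).

  Testing the sum against \<open>u = r\<close> alone does not suffice: a spiral of ten vectors may turn so far
  that its sum has a negative product with its root. The branches at the root decide what to do.
  If each of them has at most four vectors, \<open>u = r\<close> works, because a branch of \<open>m\<close> vectors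
  contributes at least \<open>- (m / 10) \<parallel>r\<parallel>\<^sup>2\<close> (\<open>small_branch_bound\<close>). Otherwise there is a branch of
  \<open>k \<ge> 5\<close> vectors, with root \<open>p\<close> say. The branch and the remaining tree of at most \<open>10 - k\<close>
  vectors are bounded separately, for a common direction \<open>u\<close> that is a combination of \<open>r\<close> and
  \<open>p\<close>. What remains is that a quadratic form in the two vectors \<open>r, p\<close> is positive definite
  (\<open>two_path_balance\<close>), which explicit rational coefficients confirm for \<open>k = 5, \<dots>, 9\<close>.
\<close>

section \<open>Quadratic bounds for paths\<close>

lemma zero_if_inner_self_nonpos:
  fixes x :: "'a::real_inner"
  assumes "x \<bullet> x \<le> 0" shows "x = 0"
  using order_antisym[OF assms inner_ge_zero] by simp

text \<open>\<open>path_sum m r t\<close>: some path of \<open>m\<close> vectors that starts at \<open>r\<close>, with each vector the parent of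
  the next one, has sum \<open>t\<close>.\<close>

inductive path_sum :: "nat \<Rightarrow> 'a::real_inner \<Rightarrow> 'a \<Rightarrow> bool" where
  single: "path_sum 1 r r"
| extend: "path_sum m s t \<Longrightarrow> s \<bullet> s \<le> s \<bullet> r \<Longrightarrow> path_sum (Suc m) r (r + t)"

lemma path_sum_repeat: "path_sum (Suc n) r (real (Suc n) *\<^sub>R r)"
proof (induction n)
  case 0
  show ?case using single[of r] by simp
next
  case (Suc n)
  have "real (Suc (Suc n)) *\<^sub>R r = (1 + real (Suc n)) *\<^sub>R r" by simp
  also have "\<dots> = r + real (Suc n) *\<^sub>R r" by (simp only: scaleR_add_left scaleR_one)
  finally show ?case using extend[OF Suc, of r] by simp
qed

text \<open>The zero vector may follow any vector, which allows short paths to be filled up.\<close>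

lemma path_sum_zeros:
  assumes "m \<ge> 1" shows "path_sum m r r"
proof (cases "m = 1")
  case False
  then obtain n where "m = Suc (Suc n)" using assms by (cases m; cases "m - 1") auto
  then show ?thesis using extend[OF path_sum_repeat[of n 0], of r] by simp
qed (use single in auto)

text \<open>A list of triples \<open>(a, b, c)\<close>, one for each vector of a path, the root first. Each triple
  is the claim that the part of the path starting there, with root \<open>s\<close> and sum \<open>t\<close>, satisfies
  \<open>u \<bullet> t \<ge> - a \<parallel>s\<parallel>\<^sup>2 + b (u \<bullet> s) - c \<parallel>u\<parallel>\<^sup>2\<close> for all \<open>u\<close>; for the last vector, where
  \<open>t = s\<close>, it is \<open>(0, 1, 0)\<close>. The conditions say that a triple follows from the next one by
  \<open>bound_step\<close> with the multiplier \<open>l = 2 a (b' - 1) / (2 b' - 2 - b)\<close>, the only one that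
  produces the coefficient \<open>b'\<close>. They are inequalities in \<open>a'\<close> and \<open>c'\<close>, which may thus be rounded
  up, but an equation for \<open>b'\<close>, since \<open>u \<bullet> s\<close> has no sign. From \<open>(0, 1, 0)\<close> every
  \<open>l\<close> leads to \<open>b' = 3/2\<close>.\<close>

fun path_cert :: "(real \<times> real \<times> real) list \<Rightarrow> bool" where
  "path_cert [] \<longleftrightarrow> False"
| "path_cert [(a, b, c)] \<longleftrightarrow> a = 0 \<and> b = 1 \<and> c = 0"
| "path_cert [(a', b', c'), (a, b, c)] \<longleftrightarrow>
     0 < a' \<and> b' = 3/2 \<and> 1 \<le> 16 * a' * c' \<and> path_cert [(a, b, c)]"
| "path_cert ((a', b', c') # (a, b, c) # q # qs) \<longleftrightarrow>
     0 < a \<and> 0 < b \<and> 0 < 2 * b' - 2 - b \<and>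
     a * (b' - 1)\<^sup>2 \<le> a' * b * (2 * b' - 2 - b) \<and>
     b * (2 * b' - 2 - b) \<le> 4 * a * (c' - c) \<and>
     path_cert ((a, b, c) # q # qs)"

text \<open>As \<open>s \<bullet> s - s \<bullet> r \<le> 0\<close>, any multiple \<open>l\<close> of it may be added to the lower bound. For \<open>l > a\<close> the
  coefficient of \<open>s \<bullet> s\<close> becomes positive, and the minimum over \<open>s\<close> is found by completing the
  square. It is again a bound of the same shape, with \<open>r\<close> in the place of \<open>s\<close>.\<close>

lemma bound_step:
  fixes u r s t :: "'a::real_inner"
  assumes t: "- a * (s \<bullet> s) + b * (u \<bullet> s) - c * (u \<bullet> u) \<le> u \<bullet> t"
    and s: "s \<bullet> s \<le> s \<bullet> r" and l: "0 \<le> l" "a < l"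
    and a': "l\<^sup>2 \<le> 4 * (l - a) * a'"
    and b': "2 * (l - a) * (b' - 1) = b * l"
    and c': "b\<^sup>2 \<le> 4 * (l - a) * (c' - c)"
  shows "- a' * (r \<bullet> r) + b' * (u \<bullet> r) - c' * (u \<bullet> u) \<le> u \<bullet> (r + t)"
proof -
  define d where "d = l - a"
  have d: "d > 0" using l by (simp add: d_def)
  have m1: "l\<^sup>2 * (r \<bullet> r) \<le> (4 * d * a') * (r \<bullet> r)"
    using a' by (intro mult_right_mono) (auto simp: d_def)
  have m2: "b\<^sup>2 * (u \<bullet> u) \<le> (4 * d * (c' - c)) * (u \<bullet> u)"
    using c' by (intro mult_right_mono) (auto simp: d_def)
  have m3: "2 * (b * l) * (u \<bullet> r) = 2 * (2 * d * (b' - 1)) * (u \<bullet> r)"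
    using b' by (simp add: d_def)
  have "0 \<le> ((2 * d) *\<^sub>R s + b *\<^sub>R u - l *\<^sub>R r) \<bullet> ((2 * d) *\<^sub>R s + b *\<^sub>R u - l *\<^sub>R r)"
    by (rule inner_ge_zero)
  also have "\<dots> = 4 * d * (d * (s \<bullet> s) + b * (u \<bullet> s) - l * (s \<bullet> r))
      + l\<^sup>2 * (r \<bullet> r) - 2 * (b * l) * (u \<bullet> r) + b\<^sup>2 * (u \<bullet> u)"
    by (simp add: inner_simps inner_commute algebra_simps power2_eq_square)
  also have "\<dots> \<le> 4 * d * (d * (s \<bullet> s) + b * (u \<bullet> s) - l * (s \<bullet> r))
      + (4 * d * a') * (r \<bullet> r) - 2 * (2 * d * (b' - 1)) * (u \<bullet> r) + (4 * d * (c' - c)) * (u \<bullet> u)"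
    using m1 m2 m3 by linarith
  also have "\<dots> = 4 * d * (d * (s \<bullet> s) + b * (u \<bullet> s) - l * (s \<bullet> r)
      + a' * (r \<bullet> r) - (b' - 1) * (u \<bullet> r) + (c' - c) * (u \<bullet> u))"
    by (simp add: algebra_simps)
  finally have "0 \<le> d * (s \<bullet> s) + b * (u \<bullet> s) - l * (s \<bullet> r)
      + a' * (r \<bullet> r) - (b' - 1) * (u \<bullet> r) + (c' - c) * (u \<bullet> u)"
    using d by (simp add: zero_le_mult_iff)
  moreover have "l * (s \<bullet> s) \<le> l * (s \<bullet> r)" using s l(1) by (rule mult_left_mono)
  ultimately show ?thesis using t by (simp add: d_def inner_simps algebra_simps)
qed

lemma path_cert_bound:
  fixes u r t :: "'a::real_inner"
  assumes "path_cert ((a, b, c) # qs)" and "path_sum (Suc (length qs)) r t"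
  shows "- a * (r \<bullet> r) + b * (u \<bullet> r) - c * (u \<bullet> u) \<le> u \<bullet> t"
  using assms
proof (induction "(a, b, c) # qs" arbitrary: a b c qs r t rule: path_cert.induct)
  case (2 a b c)
  from 2(2) have "t = r" by (cases rule: path_sum.cases) (auto elim: path_sum.cases)
  then show ?case using 2 by simp
next
  case (3 a' b' c' a b c)
  from 3(3) obtain s t' where t: "t = r + t'" "path_sum 1 s t'" "s \<bullet> s \<le> s \<bullet> r"
    by (cases rule: path_sum.cases) auto
  have "t' = s" using t(2) by (cases rule: path_sum.cases) (auto elim: path_sum.cases)
  have c: "a' > 0" "b' = 3/2" "1 \<le> 16 * a' * c'" using 3 by auto
  show ?case unfolding t(1)
    by (rule bound_step[where a = 0 and b = 1 and c = 0 and l = "4 * a'", OF _ t(3)])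
      (use c \<open>t' = s\<close> in \<open>auto simp: power2_eq_square\<close>)
next
  case (4 a' b' c' a b c q qs)
  from 4(3) obtain s t' where t: "t = r + t'" "path_sum (Suc (length (q # qs))) s t'" "s \<bullet> s \<le> s \<bullet> r"
    by (cases rule: path_sum.cases) auto
  define e where "e = 2 * b' - 2 - b"
  have c: "0 < a" "0 < b" "0 < e" "a * (b' - 1)\<^sup>2 \<le> a' * b * e" "b * e \<le> 4 * a * (c' - c)"
    "path_cert ((a, b, c) # q # qs)"
    using 4(2) by (auto simp: e_def)
  define l where "l = a + a * b / e"
  have le: "l = 2 * a * (b' - 1) / e"
    using c(3) by (simp add: l_def field_simps) (simp add: e_def algebra_simps)
  have IH: "- a * (s \<bullet> s) + b * (u \<bullet> s) - c * (u \<bullet> u) \<le> u \<bullet> t'"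
    by (rule 4(1)[OF c(6) t(2)])
  show ?case unfolding t(1)
  proof (rule bound_step[OF IH t(3), of l])
    show "0 \<le> l" "a < l" using c by (auto simp: l_def)
    have "l\<^sup>2 = 4 * a / e\<^sup>2 * (a * (b' - 1)\<^sup>2)" by (simp add: le power2_eq_square field_simps)
    also have "\<dots> \<le> 4 * a / e\<^sup>2 * (a' * b * e)" using c by (intro mult_left_mono) auto
    also have "\<dots> = 4 * (l - a) * a'" using c by (simp add: l_def power2_eq_square field_simps)
    finally show "l\<^sup>2 \<le> 4 * (l - a) * a'" .
    show "2 * (l - a) * (b' - 1) = b * l" 
    proof -
      have "l - a = a * b / e" by (simp add: l_def)
      then show ?thesis by (simp add: le)
    qed
    have "b\<^sup>2 = b / e * (b * e)" using c by (simp add: power2_eq_square)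
    also have "\<dots> \<le> b / e * (4 * a * (c' - c))" using c by (intro mult_left_mono) auto
    also have "\<dots> = 4 * (l - a) * (c' - c)" by (simp add: l_def)
    finally show "b\<^sup>2 \<le> 4 * (l - a) * (c' - c)" .
  qed
qed

section \<open>Trees and their reduction to paths\<close>

definition arborescence :: "('a::real_inner \<Rightarrow> 'a) \<Rightarrow> 'a \<Rightarrow> 'a set \<Rightarrow> bool" where
  "arborescence f v S \<longleftrightarrow> finite S \<and> v \<in> S \<and>
     (\<forall>x\<in>S - {v}. f x \<in> S \<and> x \<bullet> x \<le> x \<bullet> f x \<and> norm x < norm (f x))"

text \<open>The ancestors \<open>Q\<close> of \<open>z\<close> turn a path starting at \<open>z\<close> into a path starting at the root. The
  path below \<open>z\<close> is arbitrary because its length is chosen only after \<open>Q\<close> is known. Strictly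
  increasing norms keep the ancestors distinct.\<close>

lemma climb_to_root:
  assumes S: "arborescence f v S" and "z \<in> S"
  shows "\<exists>Q\<subseteq>S. (\<forall>x\<in>Q. norm z < norm x) \<and>
    (\<forall>m t. path_sum m z t \<longrightarrow> path_sum (m + card Q) v (t + \<Sum>Q))"
  using assms(2)
proof (induction "card {x\<in>S. norm z < norm x}" arbitrary: z rule: less_induct)
  case less
  have fin: "finite S" using S by (simp add: arborescence_def)
  show ?case
  proof (cases "z = v")
    case True
    then show ?thesis by (intro exI[of _ "{}"]) auto
  next
    case False
    then have f: "f z \<in> S" "z \<bullet> z \<le> z \<bullet> f z" "norm z < norm (f z)"
      using S less.prems by (auto simp: arborescence_def)
    have "card {x\<in>S. norm (f z) < norm x} < card {x\<in>S. norm z < norm x}"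
      using fin f by (intro psubset_card_mono) auto
    from less.hyps[OF this f(1)]
    obtain Q where Q: "Q \<subseteq> S" "\<forall>x\<in>Q. norm (f z) < norm x"
      "\<And>m t. path_sum m (f z) t \<Longrightarrow> path_sum (m + card Q) v (t + \<Sum>Q)" by auto
    have q: "finite Q" "f z \<notin> Q" using Q fin by (auto intro: finite_subset)
    have "path_sum (m + card (insert (f z) Q)) v (t + \<Sum>(insert (f z) Q))"
      if "path_sum m z t" for m t
      using Q(3)[OF extend[OF that f(2)]] q by (simp add: algebra_simps)
    then show ?thesis using Q(1,2) f
      by (intro exI[of _ "insert (f z) Q"]) auto
  qed
qed

text \<open>The path goes from the root to the minimizer \<open>w\<close> of \<open>u\<close> and then repeats \<open>w\<close>, once for each
  vector that the path misses. If \<open>u\<close> is nonpositive at \<open>w\<close>, further copies of \<open>w\<close> make up for a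
  tree with fewer than \<open>M\<close> vectors; if \<open>u\<close> is positive on the whole tree, the root followed by zeros
  does it.\<close>

lemma exists_path_below:
  fixes u :: "'a::real_inner"
  assumes S: "arborescence f v S" and M: "card S \<le> M"
  shows "\<exists>t. path_sum M v t \<and> u \<bullet> t \<le> u \<bullet> \<Sum>S"
proof -
  have fin: "finite S" and v: "v \<in> S" using S by (auto simp: arborescence_def)
  have M1: "M \<ge> 1" using M fin v by (metis One_nat_def Suc_leI card_gt_0_iff empty_iff le_trans)
  have "\<exists>w\<in>S. \<forall>x\<in>S. u \<bullet> w \<le> u \<bullet> x"
    using fin v by (metis arg_min_if_finite(1) arg_min_least empty_iff)
  then obtain w where w: "w \<in> S" "\<And>x. x \<in> S \<Longrightarrow> u \<bullet> w \<le> u \<bullet> x" by blast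
  show ?thesis
  proof (cases "u \<bullet> w \<le> 0")
    case False
    have "u \<bullet> v \<le> (\<Sum>x\<in>S. u \<bullet> x)"
      using w False fin v by (intro member_le_sum) force+
    then show ?thesis using path_sum_zeros[OF M1, of v] by (auto simp: inner_sum_right)
  next
    case True
    obtain Q where Q: "Q \<subseteq> S" "\<forall>x\<in>Q. norm w < norm x"
      "\<And>m t. path_sum m w t \<Longrightarrow> path_sum (m + card Q) v (t + \<Sum>Q)"
      using climb_to_root[OF S w(1)] by blast
    have q: "finite Q" "w \<notin> Q" using Q fin by (auto intro: finite_subset)
    define R where "R = S - insert w Q"
    have SR: "S = R \<union> insert w Q" "R \<inter> insert w Q = {}" "finite R"
      using Q w fin by (auto simp: R_def)
    have card: "card S = card R + Suc (card Q)"
      unfolding SR(1) using SR q by (subst card_Un_disjoint) auto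
    define n where "n = M - Suc (card Q)"
    have n: "M = Suc n + card Q" "card R \<le> n" using card M by (auto simp: n_def)
    have path: "path_sum M v (real (Suc n) *\<^sub>R w + \<Sum>Q)"
      unfolding n(1) by (rule Q(3)[OF path_sum_repeat])
    have "real n * (u \<bullet> w) \<le> real (card R) * (u \<bullet> w)"
      using True n(2) by (intro mult_right_mono_neg) auto
    also have "\<dots> \<le> (\<Sum>x\<in>R. u \<bullet> x)"
      using w(2) SR by (intro sum_bounded_below) auto
    finally have "u \<bullet> (real (Suc n) *\<^sub>R w + \<Sum>Q) \<le> (\<Sum>x\<in>R. u \<bullet> x) + u \<bullet> w + (\<Sum>x\<in>Q. u \<bullet> x)"
      by (simp add: inner_simps inner_sum_right algebra_simps)
    also have "\<dots> = u \<bullet> \<Sum>S"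
      unfolding SR(1) inner_sum_right using SR q by (subst sum.union_disjoint) auto
    finally show ?thesis using path by blast
  qed
qed

text \<open>The longest vector other than the root is a child \<open>p\<close> of the root; \<open>D\<close> consists of its
  descendants.\<close>

lemma split_branch:
  assumes S: "arborescence f \<rho> S" and "S \<noteq> {\<rho>}"
  shows "\<exists>D p. D \<subseteq> S \<and> p \<bullet> p \<le> p \<bullet> \<rho> \<and> f p = \<rho> \<and> arborescence f p D \<and> arborescence f \<rho> (S - D)"
proof -
  have fin: "finite S" "finite (S - {\<rho>})" and \<rho>: "\<rho> \<in> S" using S by (auto simp: arborescence_def)
  have ne: "S - {\<rho>} \<noteq> {}" using assms \<rho> by auto
  have "\<exists>p\<in>S - {\<rho>}. \<forall>x\<in>S - {\<rho>}. norm x \<le> norm p"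
    using arg_min_if_finite(1)[OF fin(2) ne] arg_min_least[OF fin(2) ne, of _ "\<lambda>x. - norm x"]
    by (metis neg_le_iff_le)
  then obtain p where p: "p \<in> S" "p \<noteq> \<rho>" "\<And>x. x \<in> S - {\<rho>} \<Longrightarrow> norm x \<le> norm p" by blast
  have fp: "f p = \<rho>" and pp: "p \<bullet> p \<le> p \<bullet> \<rho>"
  proof -
    have "f p \<in> S" "p \<bullet> p \<le> p \<bullet> f p" "norm p < norm (f p)" using S p by (auto simp: arborescence_def)
    then show "f p = \<rho>" using p(3)[of "f p"] by force
    then show "p \<bullet> p \<le> p \<bullet> \<rho>" using \<open>p \<bullet> p \<le> p \<bullet> f p\<close> by simp
  qed
  define E where "E = {(x, f x) |x. x \<in> S - {\<rho>}}"
  define D where "D = {x\<in>S. (x, p) \<in> E\<^sup>*}"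
  have step: "f x \<in> D" if x: "x \<in> D" "x \<noteq> p" for x
  proof -
    have xp: "(x, p) \<in> E\<^sup>*" using x by (simp add: D_def)
    obtain y where y: "(x, y) \<in> E" "(y, p) \<in> E\<^sup>*"
      using xp x(2) by (cases rule: converse_rtranclE) auto
    then have "x \<in> S - {\<rho>}" "y = f x" by (auto simp: E_def)
    moreover then have "f x \<in> S" using S by (auto simp: arborescence_def)
    ultimately show ?thesis using y by (simp add: D_def)
  qed
  have \<rho>D: "\<rho> \<notin> D"
  proof
    assume "\<rho> \<in> D"
    then have \<rho>p: "(\<rho>, p) \<in> E\<^sup>*" by (simp add: D_def)
    obtain y where "(\<rho>, y) \<in> E" using \<rho>p p(2) by (cases rule: converse_rtranclE) auto
    then show False by (auto simp: E_def)
  qed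
  have into_D: "x \<in> D" if "x \<in> S - {\<rho>}" "f x \<in> D" for x
    using that by (auto simp: D_def E_def intro: converse_rtrancl_into_rtrancl)
  have "arborescence f p D"
    unfolding arborescence_def
  proof (intro conjI ballI)
    show "finite D" "p \<in> D" using fin p by (auto simp: D_def)
    fix x assume x: "x \<in> D - {p}"
    then show "f x \<in> D" using step by blast
    have "x \<in> S - {\<rho>}" using x \<rho>D by (auto simp: D_def)
    then show "x \<bullet> x \<le> x \<bullet> f x" "norm x < norm (f x)" using S by (auto simp: arborescence_def)
  qed
  moreover have "arborescence f \<rho> (S - D)"
    using S \<rho>D into_D unfolding arborescence_def by blast
  ultimately show ?thesis using fp pp by (intro exI[of _ D] exI[of _ p]) (auto simp: D_def)
qed

section \<open>Trees with sum zero\<close>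

text \<open>Add the bounds for \<open>T1\<close> and \<open>T2\<close>. The best direction \<open>u\<close> maximizes the sum
  \<open>u \<bullet> (B r + b p) - (c + C) \<parallel>u\<parallel>\<^sup>2\<close>; it is \<open>u = 2 h (B r + b p)\<close> and gives the value
  \<open>h \<parallel>B r + b p\<parallel>\<^sup>2\<close>. With \<open>p \<bullet> p - p \<bullet> r \<le> 0\<close> added as well, a quadratic form in \<open>r\<close> and
  \<open>p\<close> is nonpositive, while the assumptions \<open>pos\<close> say that it is positive definite.\<close>

lemma two_path_balance:
  fixes r p T1 T2 :: "'a::real_inner"
  assumes bal: "T1 + T2 = 0" and p: "p \<bullet> p \<le> p \<bullet> r"
    and T1: "\<And>u. - a * (p \<bullet> p) + b * (u \<bullet> p) - c * (u \<bullet> u) \<le> u \<bullet> T1"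
    and T2: "\<And>u. - A * (r \<bullet> r) + B * (u \<bullet> r) - C * (u \<bullet> u) \<le> u \<bullet> T2"
    and h: "h * (4 * (c + C)) = 1"
    and pos: "0 < B\<^sup>2 * h - A"
      "(2 * b * B * h - 1)\<^sup>2 < 4 * (B\<^sup>2 * h - A) * (1 - a + b\<^sup>2 * h)"
  shows "r = 0"
proof -
  define X Y Z where "X = B\<^sup>2 * h - A" and "Y = 1 - a + b\<^sup>2 * h" and "Z = 2 * b * B * h - 1"
  define w where "w = B *\<^sub>R r + b *\<^sub>R p"
  define u where "u = (2 * h) *\<^sub>R w"
  have "u \<bullet> T1 + u \<bullet> T2 = 0" using bal by (metis inner_add_right inner_zero_right)
  then have le0: "- A * (r \<bullet> r) - a * (p \<bullet> p) + (u \<bullet> w - (c + C) * (u \<bullet> u)) \<le> 0"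
    using T1[of u] T2[of u] by (simp add: w_def inner_simps algebra_simps)
  have eq: "u \<bullet> w - (c + C) * (u \<bullet> u) = h * (w \<bullet> w)"
  proof -
    have "(c + C) * (u \<bullet> u) = (h * (4 * (c + C))) * h * (w \<bullet> w)"
      by (simp add: u_def algebra_simps)
    then show ?thesis unfolding h by (simp add: u_def)
  qed
  have neg: "X * (r \<bullet> r) + Z * (p \<bullet> r) + Y * (p \<bullet> p) \<le> 0"
    using p le0 unfolding eq by (simp add: w_def X_def Y_def Z_def inner_simps inner_commute power2_eq_square algebra_simps)
  have "((2 * X) *\<^sub>R r + Z *\<^sub>R p) \<bullet> ((2 * X) *\<^sub>R r + Z *\<^sub>R p) + (4 * X * Y - Z\<^sup>2) * (p \<bullet> p)
      = 4 * X * (X * (r \<bullet> r) + Z * (p \<bullet> r) + Y * (p \<bullet> p))"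
    by (simp add: inner_simps inner_commute power2_eq_square algebra_simps)
  also have "\<dots> \<le> 0" using neg pos by (simp add: X_def mult_le_0_iff)
  finally have le: "((2 * X) *\<^sub>R r + Z *\<^sub>R p) \<bullet> ((2 * X) *\<^sub>R r + Z *\<^sub>R p) + (4 * X * Y - Z\<^sup>2) * (p \<bullet> p) \<le> 0" .
  have D: "4 * X * Y - Z\<^sup>2 > 0" using pos by (simp add: X_def Y_def Z_def)
  then have "(4 * X * Y - Z\<^sup>2) * (p \<bullet> p) \<le> 0"
    using le inner_ge_zero[of "(2 * X) *\<^sub>R r + Z *\<^sub>R p"] by linarith
  then have "p = 0" using D by (intro zero_if_inner_self_nonpos) (simp add: mult_le_0_iff)
  then have "4 * X\<^sup>2 * (r \<bullet> r) \<le> 0" using le by (simp add: power2_eq_square algebra_simps)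
  then show ?thesis
    using pos(1) by (intro zero_if_inner_self_nonpos) (simp add: X_def mult_le_0_iff)
qed

text \<open>The first list is for the branch at \<open>p\<close>, the second one for the tree that remains.\<close>

fun pair_cert :: "(real \<times> real \<times> real) list \<Rightarrow> (real \<times> real \<times> real) list \<Rightarrow> bool" where
  "pair_cert ((a, b, c) # ps) ((A, B, C) # qs) \<longleftrightarrow>
     path_cert ((a, b, c) # ps) \<and> path_cert ((A, B, C) # qs) \<and> 0 < c + C \<and>
     (let h = 1 / (4 * (c + C)) in 0 < B\<^sup>2 * h - A \<and>
      (2 * b * B * h - 1)\<^sup>2 < 4 * (B\<^sup>2 * h - A) * (1 - a + b\<^sup>2 * h))"
| "pair_cert _ _ \<longleftrightarrow> False"

lemma pair_cert_balance:
  assumes cert: "pair_cert ps qs"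
    and D: "arborescence f p D" "card D \<le> length ps" and R: "arborescence f r R" "card R \<le> length qs"
    and bal: "\<Sum>D + \<Sum>R = 0" and p: "p \<bullet> p \<le> p \<bullet> r"
  shows "r = 0"
proof -
  obtain a b c ps' A B C qs' where eq: "ps = (a, b, c) # ps'" "qs = (A, B, C) # qs'"
    using cert by (cases "(ps, qs)" rule: pair_cert.cases) auto
  define h where "h = 1 / (4 * (c + C))"
  have c: "path_cert ((a, b, c) # ps')" "path_cert ((A, B, C) # qs')" "0 < c + C"
    "0 < B\<^sup>2 * h - A" "(2 * b * B * h - 1)\<^sup>2 < 4 * (B\<^sup>2 * h - A) * (1 - a + b\<^sup>2 * h)"
    using cert by (auto simp: eq h_def Let_def)
  have T1: "- a * (p \<bullet> p) + b * (u \<bullet> p) - c * (u \<bullet> u) \<le> u \<bullet> \<Sum>D" for u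
  proof -
    obtain t where "path_sum (length ps) p t" "u \<bullet> t \<le> u \<bullet> \<Sum>D" using exists_path_below[OF D] by blast
    then show ?thesis using path_cert_bound[OF c(1), of p t u] by (simp add: eq)
  qed
  have T2: "- A * (r \<bullet> r) + B * (u \<bullet> r) - C * (u \<bullet> u) \<le> u \<bullet> \<Sum>R" for u
  proof -
    obtain t where "path_sum (length qs) r t" "u \<bullet> t \<le> u \<bullet> \<Sum>R" using exists_path_below[OF R] by blast
    then show ?thesis using path_cert_bound[OF c(2), of r t u] by (simp add: eq)
  qed
  show ?thesis
    by (rule two_path_balance[OF bal p T1 T2 _ c(4,5)]) (use c(3) in \<open>simp add: h_def\<close>)
qed

text \<open>The five possible sizes of a large branch. For each of them the existence of suitable bounds is
  the feasibility of a semidefinite program, and the numbers are a numerical solution in which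
  \<open>a\<close> and \<open>c\<close> are rounded up. The triples are chosen for each size anew, because good bounds for
  a path of one length need not extend to good bounds for a longer one.\<close>

lemma pair_cert_5: "pair_cert
    [(1.253, 3.202, 1.632), (1.252, 2.194, 0.663), (0.847, 1.873, 0.378), (0.41, 1.5, 0.153), (0, 1, 0)]
    [(0.926, 5.919, 7.817), (0.694, 2.457, 1.284), (0.616, 1.945, 0.519), (0.403, 1.5, 0.156), (0, 1, 0)]"
  by (simp add: Let_def power2_eq_square)

lemma pair_cert_6: "pair_cert
    [(1.5, 3.71, 2.36), (1.49, 2.66, 1.12), (1.36, 2.15, 0.65), (0.87, 1.84, 0.4), (0.33, 1.5, 0.19), (0, 1, 0)]
    [(0.43, 3.22, 3.66), (0.42, 1.93, 0.77), (0.26, 1.5, 0.25), (0, 1, 0)]"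
  by (simp add: Let_def power2_eq_square)

lemma pair_cert_7: "pair_cert
    [(1.8, 4.31, 3.17), (1.78, 2.98, 1.64), (1.62, 2.56, 1.08), (1.24, 2.31, 0.7), (0.95, 1.94, 0.35),
     (0.61, 1.5, 0.11), (0, 1, 0)]
    [(0.24, 2.28, 2.01), (0.23, 1.5, 0.28), (0, 1, 0)]"
  by (simp add: Let_def power2_eq_square)

lemma pair_cert_8: "pair_cert
    [(3.05, 6.56, 4.39), (2.63, 3.51, 1.85), (2.59, 2.8, 1.25), (2.27, 2.43, 0.93), (1.72, 2.13, 0.7),
     (1.15, 1.78, 0.51), (0.17, 1.5, 0.37), (0, 1, 0)]
    [(0.09, 1.5, 0.7), (0, 1, 0)]"
  by (simp add: Let_def power2_eq_square)

lemma pair_cert_9: "pair_cert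
    [(5.55, 10.03, 5.42), (3.64, 3.74, 1.74), (3.6, 2.99, 1.22), (3.22, 2.63, 0.94), (2.59, 2.35, 0.73),
     (1.83, 2.08, 0.55), (0.97, 1.82, 0.39), (0.3, 1.5, 0.21), (0, 1, 0)]
    [(0, 1, 0)]"
  by (simp add: Let_def power2_eq_square)

text \<open>With \<open>u = r\<close>, a bound with \<open>a \<le> b\<close> and \<open>p \<bullet> p \<le> p \<bullet> r\<close> leave only the term
  \<open>- c \<parallel>r\<parallel>\<^sup>2\<close>. Being linear in the size of the branch, the estimate can be summed over any
  number of branches.\<close>

lemma small_branch_bound:
  fixes p r :: "'a::real_inner"
  assumes D: "arborescence f p D" "card D \<le> 4" and p: "p \<bullet> p \<le> p \<bullet> r"
  shows "- (real (card D) / 10) * (r \<bullet> r) \<le> r \<bullet> \<Sum>D"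
proof -
  have gen: "- (real (card D) / 10) * (r \<bullet> r) \<le> r \<bullet> \<Sum>D"
    if cert: "path_cert ((a, b, c) # qs)" "Suc (length qs) = card D" "a \<le> b" "0 \<le> b"
      "c \<le> real (card D) / 10" for a b c qs
  proof -
    obtain t where t: "path_sum (Suc (length qs)) p t" "r \<bullet> t \<le> r \<bullet> \<Sum>D"
      using exists_path_below[OF D(1), of "card D" r] cert(2) by auto
    have "- (real (card D) / 10) * (r \<bullet> r) \<le> - c * (r \<bullet> r)"
      using cert(5) by (intro mult_right_mono) auto
    also have "a * (p \<bullet> p) \<le> b * (p \<bullet> r)"
      using cert(3,4) p by (intro mult_mono) auto
    then have "- c * (r \<bullet> r) \<le> - a * (p \<bullet> p) + b * (r \<bullet> p) - c * (r \<bullet> r)"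
      by (simp add: inner_commute)
    also have "\<dots> \<le> r \<bullet> \<Sum>D" using path_cert_bound[OF cert(1) t(1), of r] t(2) by linarith
    finally show ?thesis .
  qed
  have "card D > 0" using D(1) by (auto simp: arborescence_def card_gt_0_iff)
  with D(2) consider "card D = 1" | "card D = 2" | "card D = 3" | "card D = 4" by linarith
  then show ?thesis
  proof cases
    case 1
    then show ?thesis by (intro gen[of "0" "1" "0" "[]"]) auto
  next
    case 2
    then show ?thesis by (intro gen[of "1.1" "1.5" "0.1" "[(0, 1, 0)]"]) auto
  next
    case 3
    then show ?thesis
      by (intro gen[of "2" "2.2" "0.3" "[(1.8, 1.5, 0.1), (0, 1, 0)]"]) (auto simp: power2_eq_square)
  next
    case 4
    then show ?thesis
      by (intro gen[of "2.53" "2.57" "0.39" "[(2.37, 1.96, 0.14), (1.62, 1.5, 0.04), (0, 1, 0)]"])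
        (auto simp: power2_eq_square)
  qed
qed

text \<open>Small branches are cut off one after the other. A large branch found in what is left can be
  cut off from the whole tree as well: the small branch hangs directly on the root, so that putting
  it back leaves the remainder a tree.\<close>

lemma big_branch_or_bound:
  fixes r :: "'a::real_inner"
  assumes "arborescence f r S"
  shows "(\<exists>D p. D \<subseteq> S \<and> p \<bullet> p \<le> p \<bullet> r \<and> arborescence f p D \<and> arborescence f r (S - D) \<and> 5 \<le> card D)
    \<or> (1 - (real (card S) - 1) / 10) * (r \<bullet> r) \<le> r \<bullet> \<Sum>S"
  using assms
proof (induction "card S" arbitrary: S rule: less_induct)
  case less
  have fin: "finite S" using less.prems by (simp add: arborescence_def)
  show ?case
  proof (cases "S = {r}")
    case True
    then show ?thesis by simp
  next
    case False
    obtain D p where D: "D \<subseteq> S" "p \<bullet> p \<le> p \<bullet> r" "f p = r" "arborescence f p D"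
      "arborescence f r (S - D)"
      using split_branch[OF less.prems False] by blast
    have pD: "p \<in> D" "r \<in> S - D" using D by (auto simp: arborescence_def)
    have card: "card S = card D + card (S - D)"
      using D(1) fin by (simp add: card_Diff_subset finite_subset card_mono)
    have "card D > 0" using pD D(1) fin by (auto simp: card_gt_0_iff intro: finite_subset)
    then have lt: "card (S - D) < card S" using card by simp
    show ?thesis
    proof (cases "5 \<le> card D")
      case True
      then show ?thesis using D by blast
    next
      case small: False
      from less.hyps[OF lt D(5)] show ?thesis
      proof (elim disjE exE conjE)
        fix D' p'
        assume D': "D' \<subseteq> S - D" "p' \<bullet> p' \<le> p' \<bullet> r" "arborescence f p' D'"
          "arborescence f r (S - D - D')" "5 \<le> card D'"
        have "arborescence f r (S - D')"
          using less.prems D D' pD unfolding arborescence_def by blast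
        then show ?thesis using D' by blast
      next
        assume rest: "(1 - (real (card (S - D)) - 1) / 10) * (r \<bullet> r) \<le> r \<bullet> \<Sum>(S - D)"
        have "- (real (card D) / 10) * (r \<bullet> r) \<le> r \<bullet> \<Sum>D"
          using small_branch_bound[OF D(4) _ D(2)] small by simp
        moreover have "\<Sum>S = \<Sum>(S - D) + \<Sum>D" using D(1) fin by (simp add: sum.subset_diff)
        moreover have "(1 - (real (card S) - 1) / 10) * (r \<bullet> r) =
            (1 - (real (card (S - D)) - 1) / 10) * (r \<bullet> r) + - (real (card D) / 10) * (r \<bullet> r)"
          by (simp add: card field_simps)
        ultimately have "(1 - (real (card S) - 1) / 10) * (r \<bullet> r) \<le> r \<bullet> \<Sum>S"
          using rest by (simp only: inner_add_right)
        then show ?thesis ..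
      qed
    qed
  qed
qed

lemma balanced_arborescence:
  fixes r :: "'a::real_inner"
  assumes S: "arborescence f r S" "card S \<le> 10" and bal: "\<Sum>S = 0"
  shows "r = 0"
  using big_branch_or_bound[OF S(1)]
proof (elim disjE exE conjE)
  fix D p
  assume D: "D \<subseteq> S" "p \<bullet> p \<le> p \<bullet> r" "arborescence f p D" "arborescence f r (S - D)" "5 \<le> card D"
  have fin: "finite S" using S by (simp add: arborescence_def)
  have card: "card S = card D + card (S - D)"
    using D(1) fin by (simp add: card_Diff_subset finite_subset card_mono)
  have "card (S - D) > 0" using D(4) by (auto simp: arborescence_def card_gt_0_iff)
  then have "card D \<le> 9" using card S by linarith
  have sum: "\<Sum>D + \<Sum>(S - D) = 0" using bal D(1) fin by (simp add: sum.subset_diff add.commute)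
  have *: "r = 0" if "pair_cert ps qs" "card D = length ps" "length ps + length qs = 10" for ps qs
    using pair_cert_balance[OF that(1) D(3) _ D(4) _ sum D(2)] that card S(2) by simp
  from \<open>5 \<le> card D\<close> \<open>card D \<le> 9\<close> consider
    "card D = 5" | "card D = 6" | "card D = 7" | "card D = 8" | "card D = 9" by linarith
  then show ?thesis
    by cases (auto intro: *[OF pair_cert_5] *[OF pair_cert_6] *[OF pair_cert_7] *[OF pair_cert_8]
      *[OF pair_cert_9])
next
  assume "(1 - (real (card S) - 1) / 10) * (r \<bullet> r) \<le> r \<bullet> \<Sum>S"
  then have "(1 - (real (card S) - 1) / 10) * (r \<bullet> r) \<le> 0" using bal by simp
  moreover have "1 - (real (card S) - 1) / 10 > 0" using S(2) by simp
  ultimately have "r \<bullet> r \<le> 0" by (metis mult_pos_pos not_le)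
  then show ?thesis by (rule zero_if_inner_self_nonpos)
qed

section \<open>Unstable equilibria and parents\<close>

text \<open>The hyperplane through \<open>q\<close> cuts out a face of \<open>P\<close>. The extreme points of this face are vertices
  of \<open>P\<close> on the hyperplane, hence only \<open>q\<close>, and so the face is \<open>{q}\<close>. It is the only face
  with \<open>q\<close> in its relative interior because the relative interiors of distinct faces are disjoint.\<close>

lemma strict_maximum_imp_unstable:
  fixes P :: "'a::euclidean_space set"
  assumes P: "polytope P" and q: "q \<in> vertices P" "q \<noteq> g"
    and max: "\<And>v. v \<in> vertices P \<Longrightarrow> v \<noteq> q \<Longrightarrow> (q - g) \<bullet> (v - q) < 0"
  shows "unstable_equilibrium P g q"
proof -
  let ?h = "perp_hyperplane g q"
  have conv: "convex P" "compact P" using P by (auto simp: polytope_imp_convex polytope_imp_compact)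
  have hull: "P = convex hull vertices P"
    unfolding vertices_def using Krein_Milman_Minkowski[OF conv(2,1)] .
  have h: "?h = {x. (q - g) \<bullet> x = (q - g) \<bullet> q}"
    by (auto simp: perp_hyperplane_def inner_diff_right)
  have le: "(q - g) \<bullet> x \<le> (q - g) \<bullet> q" if "x \<in> P" for x
  proof -
    have "vertices P \<subseteq> {x. (q - g) \<bullet> x \<le> (q - g) \<bullet> q}"
      using max by (force simp: inner_diff_right)
    then have "convex hull vertices P \<subseteq> {x. (q - g) \<bullet> x \<le> (q - g) \<bullet> q}"
      by (rule hull_minimal) (rule convex_halfspace_le)
    then show ?thesis using that hull by blast
  qed
  have qext: "q extreme_point_of P" and qP: "q \<in> P"
    using q by (auto simp: vertices_def extreme_point_of_def)
  define F where "F = ?h \<inter> P"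
  have F: "F face_of P"
    unfolding F_def h using face_of_Int_supporting_hyperplane_le[OF conv(1) le]
    by (simp add: Int_commute)
  have "compact F" "convex F"
    using F conv face_of_imp_compact face_of_imp_convex by blast+
  then have "F = convex hull {x. x extreme_point_of F}" by (rule Krein_Milman_Minkowski)
  also have "{x. x extreme_point_of F} \<subseteq> {q}"
  proof
    fix x assume "x \<in> {x. x extreme_point_of F}"
    then have "x extreme_point_of P" "x \<in> ?h"
      using F extreme_point_of_face by (auto simp: F_def)
    then show "x \<in> {q}" using max[of x] by (auto simp: vertices_def perp_hyperplane_def)
  qed
  then have "convex hull {x. x extreme_point_of F} \<subseteq> {q}"
    using hull_mono[of _ "{q}" convex] by simp
  finally have Fq: "F = {q}" using qP by (auto simp: F_def h)
  have supp: "supports_at ?h P q"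
    unfolding supports_at_def
  proof
    show "\<exists>a b. a \<noteq> 0 \<and> ?h = {x. a \<bullet> x = b} \<and> P \<subseteq> {x. a \<bullet> x \<le> b}"
      using q(2) le h by (intro exI[of _ "q - g"] exI[of _ "(q - g) \<bullet> q"]) auto
    show "q \<in> ?h \<inter> P" using Fq by (auto simp: F_def)
  qed
  have "q \<notin> interior P" using qext extreme_point_not_in_interior by blast
  then have "q \<in> frontier P" using qP closure_subset by (auto simp: frontier_def)
  with supp have eq: "equilibrium_point P g q" by (simp add: equilibrium_point_def)
  have q_face: "{q} face_of P" using F Fq by simp
  have "{G. G face_of P \<and> 0 \<le> aff_dim G \<and> aff_dim G \<le> int DIM('a) - 1 \<and> q \<in> rel_interior G} = {{q}}"
  proof (intro equalityI subsetI)
    fix G assume "G \<in> {G. G face_of P \<and> 0 \<le> aff_dim G \<and> aff_dim G \<le> int DIM('a) - 1 \<and> q \<in> rel_interior G}"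
    then show "G \<in> {{q}}" using face_of_eq[OF _ q_face, of G] by auto
  next
    fix G assume "G \<in> {{q}}"
    then show "G \<in> {G. G face_of P \<and> 0 \<le> aff_dim G \<and> aff_dim G \<le> int DIM('a) - 1 \<and> q \<in> rel_interior G}"
      using q_face DIM_positive[where 'a = 'a] by (auto simp: Suc_le_eq)
  qed
  then show ?thesis
    using eq Fq by (simp add: unstable_equilibrium_def nondegenerate_equilibrium_def F_def)
qed

theorem corollary6:
  fixes P :: "'a::euclidean_space set"
  assumes "polytope P"
    and "aff_dim P = int DIM('a)"
    and "mono_unstable_0_skeleton P"
  shows "card (vertices P) \<ge> 11"
proof (rule ccontr)
  assume "\<not> card (vertices P) \<ge> 11"
  then have card10: "card (vertices P) \<le> 10" by simp
  let ?V = "vertices P"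
  define g where "g = center_of_mass_0_skeleton P"
  have fin: "finite ?V"
    unfolding vertices_def by (rule finite_polyhedron_extreme_points) (simp add: assms polytope_imp_polyhedron)
  have hull: "P = convex hull ?V"
    unfolding vertices_def
    by (intro Krein_Milman_Minkowski polytope_imp_compact polytope_imp_convex assms)
  have two: "\<exists>v\<in>?V. v \<noteq> q" for q
  proof (rule ccontr)
    assume "\<not> (\<exists>v\<in>?V. v \<noteq> q)"
    then have "P \<subseteq> {q}" using hull hull_mono[of ?V "{q}" convex] by auto
    then have "aff_dim P \<le> 0" using aff_dim_subset[of P "{q}"] by simp
    then show False using assms(2) DIM_positive[where 'a = 'a] by simp
  qed
  have ne: "?V \<noteq> {}" using two by blast
  define S where "S = (\<lambda>v. v - g) ` ?V"
  have inj: "inj_on (\<lambda>v. v - g) ?V" by (auto simp: inj_on_def)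
  have S: "finite S" "card S \<le> 10" "S \<noteq> {}"
    using fin card10 ne by (auto simp: S_def card_image[OF inj])
  have "real (card ?V) *\<^sub>R g = \<Sum>?V"
    using fin ne by (simp add: g_def center_of_mass_0_skeleton_def)
  then have bal: "\<Sum>S = 0"
    unfolding S_def by (simp add: sum.reindex[OF inj] sum_subtractf sum_constant_scaleR)
  have twoS: "\<exists>y\<in>S. y \<noteq> x" for x
    using two[of "x + g"] by (force simp: S_def)
  have parent: "\<exists>y\<in>S. y \<noteq> x \<and> x \<bullet> x \<le> x \<bullet> y"
    if "x \<in> S" "\<not> unstable_equilibrium P g (x + g)" for x
  proof (rule ccontr)
    assume none: "\<not> (\<exists>y\<in>S. y \<noteq> x \<and> x \<bullet> x \<le> x \<bullet> y)"
    have "x \<noteq> 0" using none twoS[of x] by auto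
    have "unstable_equilibrium P g (x + g)"
    proof (rule strict_maximum_imp_unstable[OF assms(1)])
      show "x + g \<in> ?V" "x + g \<noteq> g" using that(1) \<open>x \<noteq> 0\<close> by (auto simp: S_def)
      fix v assume "v \<in> ?V" "v \<noteq> x + g"
      then have "v - g \<in> S" "v - g \<noteq> x" by (auto simp: S_def)
      then show "(x + g - g) \<bullet> (v - (x + g)) < 0"
        using none by (force simp: inner_simps algebra_simps)
    qed
    then show False using that(2) by simp
  qed
  have norm: "norm x < norm y" if "y \<noteq> x" "x \<bullet> x \<le> x \<bullet> y" for x y :: 'a
  proof (rule ccontr)
    assume "\<not> norm x < norm y"
    then have "y \<bullet> y \<le> x \<bullet> x" by (simp add: norm_le not_less)
    then have "(y - x) \<bullet> (y - x) \<le> 0" using that(2) by (simp add: inner_simps inner_commute)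
    then have "y - x = 0" by (rule zero_if_inner_self_nonpos)
    then show False using that(1) by simp
  qed
  \<comment> \<open>A parent is longer than its child, so the longest vertex has none and must be the unstable one.\<close>
  obtain r where r: "r \<in> S" "\<And>x. x \<in> S \<Longrightarrow> norm x \<le> norm r"
    using arg_min_if_finite(1)[OF S(1,3)] arg_min_least[OF S(1,3), of _ "\<lambda>x. - norm x"]
    by (metis neg_le_iff_le)
  have r_unstable: "unstable_equilibrium P g (r + g)"
    using parent[OF r(1)] norm r(2) by (meson not_le)
  obtain q0 where q0: "{q. unstable_equilibrium P g q} = {q0}"
    using assms(3) card_1_singletonE unfolding mono_unstable_0_skeleton_def g_def by blast
  have only: "q = r + g" if "unstable_equilibrium P g q" for q
  proof -
    have "q \<in> {q0}" "r + g \<in> {q0}" unfolding q0[symmetric] using that r_unstable by simp_all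
    then show ?thesis by simp
  qed
  have "\<forall>x\<in>S - {r}. \<exists>y. y \<in> S \<and> x \<bullet> x \<le> x \<bullet> y \<and> norm x < norm y"
  proof
    fix x assume "x \<in> S - {r}"
    then have "x \<in> S" "\<not> unstable_equilibrium P g (x + g)" using only[of "x + g"] by auto
    from parent[OF this] show "\<exists>y. y \<in> S \<and> x \<bullet> x \<le> x \<bullet> y \<and> norm x < norm y" using norm by blast
  qed
  then obtain f where "\<forall>x\<in>S - {r}. f x \<in> S \<and> x \<bullet> x \<le> x \<bullet> f x \<and> norm x < norm (f x)" by metis
  then have "arborescence f r S" using S r by (simp add: arborescence_def)
  from balanced_arborescence[OF this S(2) bal] have "r = 0" .
  then have "S \<subseteq> {0}" using r(2) by auto
  then show False using twoS[of 0] by blast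
qed

end
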